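(* Let $X \subset \mathbb{R}^d$ be triangulizable. Then $X$ is convex if and only if for every line $\alpha$ in $\mathbb{R}^d$ the persistence diagram in degree $0$ with respect to the tubular filtration $\{X_{\tau_\alpha, r}\}_{r \in \mathbb{R}_{\geq 0}}$ contains exactly one interval.
   Context: **Triangulizable.** A subset $X \subset \mathbb{R}^d$ is triangulizable if there exist a simplicial complex $K$ and a homeomorphism $h \colon |K| \to X$ from the geometric realization of $K$ to $X$. **Line.** A line in $\mathbb{R}^d$ is any $1$-dimensional affine subspace (not necessarily passing through the origin). **Tubular function and tubular filtration.** Given a line $\alpha \subset \mathbb{R}^d$, the tubular function with respect to $\alpha$ is $$\tau_\alpha \colon \mathbb{R}^d \to \mathbb{R}, \qquad \tau_\alpha(x) = \mathrm{dist}(x, \alpha),$$ where $\mathrm{dist}(x,\alpha)$ is the Euclidean distance of the point $x$ from the line $\alpha$. For $X \subset \mathbb{R}^d$ and $r \in \mathbb{R}_{\geq 0}$ set $$X_{\tau_\alpha, r} = \{x \in X \mid \tau_\alpha(x) \leq r\} = \{x \in X \mid \mathrm{dist}(x, \alpha) \leq r\}.$$ The nested family $\{X_{\tau_\alpha, r}\}_{r \in \mathbb{R}_{\geq 0}}$ is the tubular filtration with respect to $\alpha$. **Persistence diagram in degree $0$.** Fix a field $k$. Applying singular homology $H_0(-;k)$ to the filtration gives a persistence module indexed by $\mathbb{R}_{\geq 0}$: the vector spaces $H_0(X_{\tau_\alpha, r}; k)$, together with the linear maps $H_0(X_{\tau_\alpha, r}; k) \to H_0(X_{\tau_\alpha,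 s}; k)$ induced by the inclusions for $r \leq s$. The persistence diagram in degree $0$ is the multiset of nonempty intervals $I \subseteq \mathbb{R}_{\geq 0}$ (possibly unbounded, or consisting of one point) appearing in a decomposition of this module as a direct sum of interval modules $k_I$. Here $k_I$ is $k$ at every $r \in I$ and $0$ elsewhere, with identity maps between indices in $I$ and zero maps otherwise. That the diagram contains exactly one interval means that the persistence module is isomorphic to a single interval module $k_I$ with $I$ nonempty.
   Formalization: X is assumed nonempty, since the empty set is triangulizable and convex but its persistence diagram contains no interval; the dimension d is at least 1 (for d = 0 there are no lines and the claim is vacuous). *)

theory Defs
  imports "HOL-Analysis.Analysis" "HOL-Homology.Homology"
begin

section \<open>Triangulizable sets\<close>

definition abstract_simplicial_complex :: "'v set set \<Rightarrow> bool" where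
  "abstract_simplicial_complex K \<longleftrightarrow>
     (\<forall>s\<in>K. finite s \<and> s \<noteq> {}) \<and> (\<forall>s\<in>K. \<forall>t. t \<noteq> {} \<and> t \<subseteq> s \<longrightarrow> t \<in> K)"

text \<open>Points are described by their barycentric coordinates.\<close>

definition closed_cell :: "'v set \<Rightarrow> ('v \<Rightarrow> real) set" where
  "closed_cell s = {t. (\<forall>v. 0 \<le> t v) \<and> (\<forall>v. v \<notin> s \<longrightarrow> t v = 0) \<and> sum t s = 1}"

text \<open>The complex may be infinite, so the realization carries the weak topology: a set is open iff
  it meets every closed simplex in a relatively open set.  On a single simplex, which has finitely
  many vertices, the product topology is the Euclidean one.\<close>

definition geometric_realization :: "'v set set \<Rightarrow> ('v \<Rightarrow> real) topology" where
  "geometric_realization K = topology (\<lambda>U. U \<subseteq> (\<Union>s\<in>K. closed_cell s) \<and>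
     (\<forall>s\<in>K. openin (subtopology (powertop_real UNIV) (closed_cell s)) (U \<inter> closed_cell s)))"

lemma openin_geometric_realization:
  "openin (geometric_realization K) U \<longleftrightarrow> U \<subseteq> (\<Union>s\<in>K. closed_cell s) \<and>
     (\<forall>s\<in>K. openin (subtopology (powertop_real UNIV) (closed_cell s)) (U \<inter> closed_cell s))"
proof -
  let ?P = "\<lambda>U. U \<subseteq> (\<Union>s\<in>K. closed_cell s) \<and>
     (\<forall>s\<in>K. openin (subtopology (powertop_real UNIV) (closed_cell s)) (U \<inter> closed_cell s))"
  have "istopology ?P"
    unfolding istopology_def
  proof (intro conjI allI impI)
    fix S T
    assume S: "?P S" and T: "?P T"
    show "S \<inter> T \<subseteq> (\<Union>s\<in>K. closed_cell s)"
      using S by blast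
    show "\<forall>s\<in>K. openin (subtopology (powertop_real UNIV) (closed_cell s)) (S \<inter> T \<inter> closed_cell s)"
    proof
      fix s assume s: "s \<in> K"
      have "openin (subtopology (powertop_real UNIV) (closed_cell s))
              ((S \<inter> closed_cell s) \<inter> (T \<inter> closed_cell s))"
        using S T s by (blast intro: openin_Int[of _ "S \<inter> closed_cell s" "T \<inter> closed_cell s"])
      moreover have "(S \<inter> closed_cell s) \<inter> (T \<inter> closed_cell s) = S \<inter> T \<inter> closed_cell s"
        by blast
      ultimately show "openin (subtopology (powertop_real UNIV) (closed_cell s))
                         (S \<inter> T \<inter> closed_cell s)"
        by simp
    qed
  next
    fix \<U> assume \<U>: "\<forall>U\<in>\<U>. ?P U"
    then show "\<Union>\<U> \<subseteq> (\<Union>s\<in>K. closed_cell s)"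
      by blast
    show "\<forall>s\<in>K. openin (subtopology (powertop_real UNIV) (closed_cell s)) (\<Union>\<U> \<inter> closed_cell s)"
    proof
      fix s assume "s \<in> K"
      then have "openin (subtopology (powertop_real UNIV) (closed_cell s))
                   (\<Union>U\<in>\<U>. U \<inter> closed_cell s)"
        using \<U> by (intro openin_Union) auto
      moreover have "(\<Union>U\<in>\<U>. U \<inter> closed_cell s) = \<Union>\<U> \<inter> closed_cell s"
        by blast
      ultimately show "openin (subtopology (powertop_real UNIV) (closed_cell s))
                         (\<Union>\<U> \<inter> closed_cell s)"
        by simp
    qed
  qed
  then show ?thesis
    by (simp add: geometric_realization_def)
qed

text \<open>Taking the vertices in the ambient type of \<open>X\<close> loses no generality: the vertices of a complex
  realizing \<open>X\<close> are sent injectively to points of \<open>X\<close> and can be renamed accordingly.\<close>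

definition triangulizable :: "'a::topological_space set \<Rightarrow> bool" where
  "triangulizable X \<longleftrightarrow> (\<exists>K :: 'a set set. abstract_simplicial_complex K \<and>
     geometric_realization K homeomorphic_space top_of_set X)"


section \<open>Singular homology with coefficients in a field\<close>

text \<open>The library's \<^const>\<open>homology_group\<close> has integer coefficients.  The definitions below are
  the analogues over a field, built on the library's singular simplices and their faces.\<close>

type_synonym ('a, 'k) kchain = "((nat \<Rightarrow> real) \<Rightarrow> 'a) \<Rightarrow>\<^sub>0 'k"

definition kchains :: "nat \<Rightarrow> 'a topology \<Rightarrow> ('a, 'k::field) kchain set" where
  "kchains p X = {c. Poly_Mapping.keys c \<subseteq> singular_simplex_set p X}"

definition kscale :: "'k::field \<Rightarrow> ('a, 'k) kchain \<Rightarrow> ('a, 'k) kchain" where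
  "kscale a c = Poly_Mapping.map ((*) a) c"

definition kboundary :: "nat \<Rightarrow> ('a, 'k::field) kchain \<Rightarrow> ('a, 'k) kchain" where
  "kboundary p c = (if p = 0 then 0 else
     (\<Sum>\<sigma>\<in>Poly_Mapping.keys c. \<Sum>i\<le>p.
        Poly_Mapping.single (singular_face p i \<sigma>) ((-1) ^ i * Poly_Mapping.lookup c \<sigma>)))"

definition kcycles :: "nat \<Rightarrow> 'a topology \<Rightarrow> ('a, 'k::field) kchain set" where
  "kcycles p X = {c \<in> kchains p X. kboundary p c = 0}"

definition kboundaries :: "nat \<Rightarrow> 'a topology \<Rightarrow> ('a, 'k::field) kchain set" where
  "kboundaries p X = kboundary (Suc p) ` kchains (Suc p) X"

definition kclass :: "nat \<Rightarrow> 'a topology \<Rightarrow> ('a, 'k::field) kchain \<Rightarrow> ('a, 'k) kchain set" where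
  "kclass p X c = {c + b |b. b \<in> kboundaries p X}"

text \<open>The quotient of cycles by boundaries, as a vector space whose elements are cosets.  The
  multiplicative fields of the \<^type>\<open>module\<close> record play no role.\<close>

definition khomology :: "nat \<Rightarrow> 'a topology \<Rightarrow> ('k::field, ('a, 'k) kchain set) module" where
  "khomology p X = \<lparr>carrier = kclass p X ` kcycles p X, mult = undefined, one = undefined,
     zero = kboundaries p X,
     add = (\<lambda>C D. {c + d |c d. c \<in> C \<and> d \<in> D}),
     smult = (\<lambda>a C. \<Union>c\<in>C. kclass p X (kscale a c))\<rparr>"

definition kchain_map ::
    "nat \<Rightarrow> ('a \<Rightarrow> 'b) \<Rightarrow> ('a, 'k::field) kchain \<Rightarrow> ('b, 'k) kchain" where
  "kchain_map p f c =
     (\<Sum>\<sigma>\<in>Poly_Mapping.keys c. Poly_Mapping.single (simplex_map p f \<sigma>) (Poly_Mapping.lookup c \<sigma>))"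

text \<open>The map into the homology of \<open>Y\<close> induced by \<open>f\<close>; it sends the coset of \<open>c\<close> to the coset of
  the image of \<open>c\<close>.\<close>

definition khom_induced :: "nat \<Rightarrow> 'b topology \<Rightarrow> ('a \<Rightarrow> 'b) \<Rightarrow>
    ('a, 'k::field) kchain set \<Rightarrow> ('b, 'k) kchain set" where
  "khom_induced p Y f C = (\<Union>c\<in>C. kclass p Y (kchain_map p f c))"


section \<open>Persistence modules\<close>

text \<open>Only the spaces at indices \<open>r \<ge> 0\<close> and the maps from index \<open>r\<close> to index \<open>s\<close> with
  \<open>0 \<le> r \<le> s\<close> are meaningful; \<open>'v\<close> is the type of vectors.\<close>

record ('k, 'v) persistence_module =
  pm_space :: "real \<Rightarrow> ('k, 'v) module"
  pm_map :: "real \<Rightarrow> real \<Rightarrow> 'v \<Rightarrow> 'v"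

definition linear_iso :: "('k, 'v) module \<Rightarrow> ('k, 'w) module \<Rightarrow> ('v \<Rightarrow> 'w) \<Rightarrow> bool" where
  "linear_iso V W f \<longleftrightarrow> bij_betw f (carrier V) (carrier W) \<and>
     (\<forall>x\<in>carrier V. \<forall>y\<in>carrier V. f (x \<oplus>\<^bsub>V\<^esub> y) = f x \<oplus>\<^bsub>W\<^esub> f y) \<and>
     (\<forall>a. \<forall>x\<in>carrier V. f (a \<odot>\<^bsub>V\<^esub> x) = a \<odot>\<^bsub>W\<^esub> f x)"

definition persistence_isomorphic ::
    "('k, 'v) persistence_module \<Rightarrow> ('k, 'w) persistence_module \<Rightarrow> bool" where
  "persistence_isomorphic P Q \<longleftrightarrow> (\<exists>\<phi>.
     (\<forall>r\<ge>0. linear_iso (pm_space P r) (pm_space Q r) (\<phi> r)) \<and>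
     (\<forall>r\<ge>0. \<forall>s\<ge>r. \<forall>x\<in>carrier (pm_space P r). \<phi> s (pm_map P r s x) = pm_map Q r s (\<phi> r x)))"

definition interval_module :: "real set \<Rightarrow> ('k::field, 'k) persistence_module" where
  "interval_module I = \<lparr>
     pm_space = (\<lambda>r. \<lparr>carrier = (if r \<in> I then UNIV else {0}), mult = (*), one = 1,
                       zero = 0, add = (+), smult = (*)\<rparr>),
     pm_map = (\<lambda>r s x. if r \<in> I \<and> s \<in> I then x else 0)\<rparr>"

definition diagram_has_exactly_one_interval :: "('k::field, 'v) persistence_module \<Rightarrow> bool" where
  "diagram_has_exactly_one_interval P \<longleftrightarrow>
     (\<exists>I. I \<noteq> {} \<and> I \<subseteq> {0..} \<and> is_interval I \<and> persistence_isomorphic P (interval_module I))"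


section \<open>Tubular filtrations\<close>

definition line :: "'a::euclidean_space set \<Rightarrow> bool" where
  "line \<alpha> \<longleftrightarrow> affine \<alpha> \<and> aff_dim \<alpha> = 1"

definition tubular_function :: "'a::euclidean_space set \<Rightarrow> 'a \<Rightarrow> real" where
  "tubular_function \<alpha> x = infdist x \<alpha>"

definition tubular_filtration :: "'a::euclidean_space set \<Rightarrow> 'a set \<Rightarrow> real \<Rightarrow> 'a set" where
  "tubular_filtration \<alpha> X r = {x \<in> X. tubular_function \<alpha> x \<le> r}"

text \<open>The persistence module of the tubular filtration in degree \<open>p\<close>; its structure maps are induced
  by the inclusions.\<close>

definition tubular_persistence_module :: "nat \<Rightarrow> 'a::euclidean_space set \<Rightarrow> 'a set \<Rightarrow>
    ('k::field, ('a, 'k) kchain set) persistence_module" where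
  "tubular_persistence_module p \<alpha> X = \<lparr>
     pm_space = (\<lambda>r. khomology p (top_of_set (tubular_filtration \<alpha> X r))),
     pm_map = (\<lambda>r s. khom_induced p (top_of_set (tubular_filtration \<alpha> X s)) (\<lambda>x. x))\<rparr>"

end

(*
  For a nonempty path-connected space the sum of coefficients identifies H_0 with the field, and it
  commutes with inclusions; since tubes around a line meet a convex set in convex sets, this gives
  one interval.  Conversely, if H_0 embeds linearly into the field, then the space is path
  connected.  The tube of radius 0 is the line itself, so the index r = 0 alone already forces
  every line section of X to be path connected, hence convex, and thus X to be convex.
*)
theory Submission
  imports Defs
begin

section \<open>Linear algebra of chains\<close>

text \<open>The linear functional on chains with value \<open>w \<sigma>\<close> on the simplex
  \<open>\<sigma>\<close>: constant weight 1 gives the coefficient sum, an indicator the total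
  weight on a path component.\<close>

definition weighted_sum :: "(((nat \<Rightarrow> real) \<Rightarrow> 'a) \<Rightarrow> 'k::field) \<Rightarrow> ('a, 'k) kchain \<Rightarrow> 'k" where
  "weighted_sum w c = (\<Sum>\<sigma>\<in>Poly_Mapping.keys c. w \<sigma> * Poly_Mapping.lookup c \<sigma>)"

lemma lookup_kscale [simp]:
  "Poly_Mapping.lookup (kscale a c) \<sigma> = a * Poly_Mapping.lookup c \<sigma>"
  by (simp add: kscale_def Poly_Mapping.map.rep_eq when_def)

lemma kscale_zero_left [simp]: "kscale 0 c = 0"
  by (rule poly_mapping_eqI) simp

lemma keys_kscale: "Poly_Mapping.keys (kscale a c) = (if a = 0 then {} else Poly_Mapping.keys c)"
  by (auto simp: in_keys_iff)

lemma kscale_single: "kscale a (Poly_Mapping.single \<sigma> b) = Poly_Mapping.single \<sigma> (a * b)"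
  by (rule poly_mapping_eqI) (simp add: lookup_single when_def)

lemma kscale_add: "kscale a (c + d) = kscale a c + kscale a d"
  by (rule poly_mapping_eqI) (simp add: lookup_add algebra_simps)

lemma kscale_diff: "kscale a (c - d) = kscale a c - kscale a d"
  by (rule poly_mapping_eqI) (simp add: lookup_minus algebra_simps)

lemma single_sum: "(\<Sum>x\<in>A. Poly_Mapping.single k (f x)) = Poly_Mapping.single k (sum f A)"
  by (induction A rule: infinite_finite_induct) (simp_all add: single_add)

lemma kscale_sum: "kscale a (sum f A) = (\<Sum>x\<in>A. kscale a (f x))"
  by (rule poly_mapping_eqI) (simp add: lookup_sum sum_distrib_left)

lemma weighted_sum_zero [simp]: "weighted_sum w 0 = 0"
  by (simp add: weighted_sum_def)

text \<open>Cancellation can shrink the support of \<open>c + d\<close>, but the summand is additive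
  in the coefficient and vanishes at zero, so the sum still splits.\<close>

lemma weighted_sum_add: "weighted_sum w (c + d) = weighted_sum w c + weighted_sum w d"
  unfolding weighted_sum_def
  by (rule setsum_keys_plus_distrib[where f = "\<lambda>\<sigma> b. w \<sigma> * b"]) (auto simp: algebra_simps)

lemma weighted_sum_sum: "weighted_sum w (sum f A) = (\<Sum>x\<in>A. weighted_sum w (f x))"
  by (induction A rule: infinite_finite_induct) (auto simp: weighted_sum_add)

lemma weighted_sum_single [simp]: "weighted_sum w (Poly_Mapping.single \<sigma> b) = w \<sigma> * b"
  by (simp add: weighted_sum_def)

lemma weighted_sum_kscale: "weighted_sum w (kscale a c) = a * weighted_sum w c"
  by (simp add: weighted_sum_def keys_kscale sum_distrib_left algebra_simps)

lemma kchain_eq_sum: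
  "c = (\<Sum>\<sigma>\<in>Poly_Mapping.keys c. Poly_Mapping.single \<sigma> (Poly_Mapping.lookup c \<sigma>))"
  by (rule poly_mapping_eqI)
    (simp add: lookup_sum lookup_single when_def in_keys_iff sum.delta'[OF finite_keys])

section \<open>Chains of a space\<close>

lemma kchains_zero [simp]: "0 \<in> kchains p X"
  by (simp add: kchains_def)

lemma kchains_add: "c \<in> kchains p X \<Longrightarrow> d \<in> kchains p X \<Longrightarrow> c + d \<in> kchains p X"
  using keys_add[of c d] by (auto simp: kchains_def)

lemma kchains_sum: "(\<And>x. x \<in> A \<Longrightarrow> f x \<in> kchains p X) \<Longrightarrow> sum f A \<in> kchains p X"
  by (induction A rule: infinite_finite_induct) (auto simp: kchains_add)

lemma kchains_kscale: "c \<in> kchains p X \<Longrightarrow> kscale a c \<in> kchains p X"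
  by (auto simp: kchains_def keys_kscale)

lemma kchains_single: "\<sigma> \<in> singular_simplex_set p X \<Longrightarrow> Poly_Mapping.single \<sigma> a \<in> kchains p X"
  by (simp add: kchains_def)

lemma kchains_mono: "S \<subseteq> T \<Longrightarrow> kchains p (subtopology X S) \<subseteq> kchains p (subtopology X T)"
  unfolding kchains_def using singular_simplex_mono by blast

lemma kchains_0_empty: "topspace X = {} \<Longrightarrow> kchains 0 X = {0}"
  by (auto simp: kchains_def singular_simplex_empty subset_iff)

section \<open>Boundary operator and boundaries\<close>

lemma kboundary_zero [simp]: "kboundary p 0 = 0"
  by (simp add: kboundary_def)

lemma kboundary_add: "kboundary p (c + d) = kboundary p c + kboundary p d"
proof -
  let ?f = "\<lambda>\<sigma> b. \<Sum>i\<le>p. Poly_Mapping.single (singular_face p i \<sigma>) ((-1) ^ i * b)"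
  have "(\<Sum>\<sigma>\<in>Poly_Mapping.keys (c + d). ?f \<sigma> (Poly_Mapping.lookup (c + d) \<sigma>)) =
      (\<Sum>\<sigma>\<in>Poly_Mapping.keys c. ?f \<sigma> (Poly_Mapping.lookup c \<sigma>)) +
      (\<Sum>\<sigma>\<in>Poly_Mapping.keys d. ?f \<sigma> (Poly_Mapping.lookup d \<sigma>))"
    by (rule setsum_keys_plus_distrib) (simp_all add: single_add algebra_simps sum.distrib)
  then show ?thesis
    by (simp add: kboundary_def)
qed

lemma kboundary_kscale: "kboundary p (kscale a c) = kscale a (kboundary p c)"
proof (cases "p = 0")
  case True
  then show ?thesis
    by (simp add: kboundary_def poly_mapping_eqI)
next
  case False
  then show ?thesis
    by (simp add: kboundary_def keys_kscale kscale_sum kscale_single mult.left_commute)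
qed

lemma kboundaries_zero [simp]: "0 \<in> kboundaries p X"
  unfolding kboundaries_def by (rule image_eqI[of _ _ 0]) auto

lemma kboundaries_add:
  "b \<in> kboundaries p X \<Longrightarrow> b' \<in> kboundaries p X \<Longrightarrow> b + b' \<in> kboundaries p X"
  unfolding kboundaries_def by (auto simp: kboundary_add[symmetric] intro!: imageI kchains_add)

lemma kboundaries_kscale: "b \<in> kboundaries p X \<Longrightarrow> kscale a b \<in> kboundaries p X"
  unfolding kboundaries_def by (auto simp: kboundary_kscale[symmetric] intro!: imageI kchains_kscale)

lemma kboundaries_sum:
  "(\<And>x. x \<in> A \<Longrightarrow> f x \<in> kboundaries p X) \<Longrightarrow> sum f A \<in> kboundaries p X"
  by (induction A rule: infinite_finite_induct) (auto simp: kboundaries_add)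

lemma kboundaries_uminus: "b \<in> kboundaries p X \<Longrightarrow> - b \<in> kboundaries p X"
proof -
  assume "b \<in> kboundaries p X"
  moreover have "kscale (-1) b = - b"
    by (rule poly_mapping_eqI) simp
  ultimately show ?thesis
    by (metis kboundaries_kscale)
qed

lemma kboundaries_mono:
  "S \<subseteq> T \<Longrightarrow> kboundaries p (subtopology X S) \<subseteq> kboundaries p (subtopology X T)"
  unfolding kboundaries_def by (intro image_mono kchains_mono)

text \<open>\<open>kboundary 0\<close> is zero by convention, so degree-zero homology is chains
  modulo boundaries.\<close>

lemma kcycles_0: "kcycles 0 X = kchains 0 X"
  by (auto simp: kcycles_def kboundary_def)

lemma kboundaries_subset_kchains: "kboundaries p X \<subseteq> kchains p X"
proof
  fix b :: "('a, 'b) kchain" assume "b \<in> kboundaries p X"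
  then obtain c where c: "c \<in> kchains (Suc p) X" and b: "b = kboundary (Suc p) c"
    by (auto simp: kboundaries_def)
  have "b = (\<Sum>\<sigma>\<in>Poly_Mapping.keys c. \<Sum>i\<le>Suc p.
      Poly_Mapping.single (singular_face (Suc p) i \<sigma>) ((-1) ^ i * Poly_Mapping.lookup c \<sigma>))"
    by (simp add: b kboundary_def del: sum.atMost_Suc)
  also have "\<dots> \<in> kchains p X"
    using c singular_simplex_singular_face[of "Suc p" X]
    by (intro kchains_sum kchains_single) (auto simp: kchains_def)
  finally show "b \<in> kchains p X" .
qed


section \<open>Homology classes\<close>

lemma kclass_self: "c \<in> kclass p X c"
  unfolding kclass_def by force

lemma kclass_eq_iff: "kclass p X c = kclass p X d \<longleftrightarrow> c - d \<in> kboundaries p X"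
proof
  assume "kclass p X c = kclass p X d"
  then have "c \<in> kclass p X d"
    using kclass_self by blast
  then show "c - d \<in> kboundaries p X"
    by (auto simp: kclass_def)
next
  have sub: "kclass p X c \<subseteq> kclass p X d" if "c - d \<in> kboundaries p X" for c d
  proof
    fix z assume "z \<in> kclass p X c"
    then obtain b where "z = c + b" "b \<in> kboundaries p X"
      by (auto simp: kclass_def)
    then have "z = d + ((c - d) + b)" "(c - d) + b \<in> kboundaries p X"
      using kboundaries_add[OF that, of b] by simp_all
    then show "z \<in> kclass p X d"
      unfolding kclass_def by blast
  qed
  assume "c - d \<in> kboundaries p X"
  then show "kclass p X c = kclass p X d"
    using sub[of c d] sub[of d c] kboundaries_uminus[of "c - d" p X] by auto
qed

text \<open>Operations on classes are encoded as unions over all representatives; when every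
  representative yields the same coset, the union collapses to it.\<close>

lemma UN_kclass:
  assumes "\<And>b. b \<in> kboundaries p X \<Longrightarrow> kclass q Y (F (c + b)) = kclass q Y (F c)"
  shows "(\<Union>d\<in>kclass p X c. kclass q Y (F d)) = kclass q Y (F c)"
proof -
  have "kclass q Y (F d) = kclass q Y (F c)" if "d \<in> kclass p X c" for d
    using that assms unfolding kclass_def[of p X c] by auto
  then show ?thesis
    using kclass_self[of c p X] by blast
qed

lemma khomology_add: "kclass p X c \<oplus>\<^bsub>khomology p X\<^esub> kclass p X d = kclass p X (c + d)"
proof (intro equalityI subsetI)
  fix z assume "z \<in> kclass p X c \<oplus>\<^bsub>khomology p X\<^esub> kclass p X d"
  then obtain b b' where "b \<in> kboundaries p X" "b' \<in> kboundaries p X" "z = (c + b) + (d + b')"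
    by (auto simp: khomology_def kclass_def)
  then show "z \<in> kclass p X (c + d)"
    unfolding kclass_def using kboundaries_add[of b p X b'] by (auto simp: algebra_simps)
next
  fix z assume "z \<in> kclass p X (c + d)"
  \<comment> \<open>The boundary is absorbed into the representative of the first class.\<close>
  then obtain b where "b \<in> kboundaries p X" "z = (c + b) + d"
    by (auto simp: kclass_def algebra_simps)
  then show "z \<in> kclass p X c \<oplus>\<^bsub>khomology p X\<^esub> kclass p X d"
    using kclass_self[of d p X] by (auto simp: khomology_def kclass_def[of p X c])
qed

lemma khomology_smult: "a \<odot>\<^bsub>khomology p X\<^esub> kclass p X c = kclass p X (kscale a c)"
  by (simp add: khomology_def, rule UN_kclass)
    (simp add: kclass_eq_iff kscale_add kboundaries_kscale)

lemma carrier_khomology_0: "carrier (khomology 0 X) = kclass 0 X ` kchains 0 X"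
  by (simp add: khomology_def kcycles_0)

section \<open>Maps induced by inclusions\<close>

lemma kchain_map_id:
  assumes "c \<in> kchains p X"
  shows "kchain_map p (\<lambda>x. x) c = c"
proof -
  \<comment> \<open>Singular simplices are extensional on the standard simplex, so the restriction
    built into \<open>simplex_map\<close> changes nothing.\<close>
  have "simplex_map p (\<lambda>x. x) \<sigma> = \<sigma>" if "\<sigma> \<in> Poly_Mapping.keys c" for \<sigma>
    using that assms by (intro simplex_map_id_gen[of p X]) (auto simp: kchains_def)
  then show ?thesis
    by (simp add: kchain_map_def kchain_eq_sum[symmetric] cong: sum.cong)
qed

lemma khom_induced_inclusion:
  assumes "S \<subseteq> T" "c \<in> kchains p (subtopology X S)"
  shows "khom_induced p (subtopology X T) (\<lambda>x. x) (kclass p (subtopology X S) c) =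
    kclass p (subtopology X T) c"
proof -
  \<comment> \<open>Boundaries are themselves chains of the subspace, so the chain map fixes every
    representative of the class.\<close>
  have eq: "kchain_map p (\<lambda>x. x) (c + b) = c + b" if "b \<in> kboundaries p (subtopology X S)" for b
    using that assms kboundaries_subset_kchains kchain_map_id kchains_add by blast
  have "kclass p (subtopology X T) (kchain_map p (\<lambda>x. x) (c + b)) =
      kclass p (subtopology X T) (kchain_map p (\<lambda>x. x) c)"
    if "b \<in> kboundaries p (subtopology X S)" for b
    using kboundaries_mono[OF assms(1)] that
    by (auto simp: eq kchain_map_id[OF assms(2)] kclass_eq_iff)
  then show ?thesis
    unfolding khom_induced_def using UN_kclass kchain_map_id[OF assms(2)] by metis
qed


section \<open>Degree zero and path components\<close>

text \<open>The only point of the standard 0-simplex; evaluation there turns a singular 0-simplex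
  into a point of the space.\<close>

abbreviation vertex0 :: "nat \<Rightarrow> real" where
  "vertex0 \<equiv> \<lambda>j. if j = 0 then 1 else 0"

text \<open>The restriction makes the constant map extensional, as singular simplices must
  be.\<close>

abbreviation point_simplex :: "'a \<Rightarrow> (nat \<Rightarrow> real) \<Rightarrow> 'a" where
  "point_simplex x \<equiv> restrict (\<lambda>_. x) (standard_simplex 0)"

lemma singular_simplex_point: "x \<in> topspace X \<Longrightarrow> singular_simplex 0 X (point_simplex x)"
  by (simp add: singular_simplex_def)

lemma singular_simplex_0D:
  assumes "singular_simplex 0 X \<sigma>"
  shows "\<sigma> = point_simplex (\<sigma> vertex0)" "\<sigma> vertex0 \<in> topspace X"
proof -
  have ext: "\<sigma> \<in> extensional (standard_simplex 0)"
    and cont: "continuous_map (subtopology (powertop_real UNIV) (standard_simplex 0)) X \<sigma>"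
    using assms by (auto simp: singular_simplex_def)
  show "\<sigma> = point_simplex (\<sigma> vertex0)"
    using ext by (rule extensionalityI) (auto simp: standard_simplex_0)
  show "\<sigma> vertex0 \<in> topspace X"
    using continuous_map_image_subset_topspace[OF cont] by (auto simp: standard_simplex_0)
qed

lemma point_simplex_vertex0 [simp]: "point_simplex x vertex0 = x"
  by (simp add: standard_simplex_0)

text \<open>The boundary of a singular 1-simplex is face 0 minus face 1, so equal weights cancel.
  Such a \<open>w\<close> therefore descends to a functional on H_0.\<close>

lemma weighted_sum_kboundaries_0:
  assumes "\<And>\<sigma>. singular_simplex 1 X \<sigma> \<Longrightarrow> w (singular_face 1 0 \<sigma>) = w (singular_face 1 1 \<sigma>)"
    and "b \<in> kboundaries 0 X"
  shows "weighted_sum w b = 0"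
proof -
  obtain c where c: "c \<in> kchains 1 X" and b: "b = kboundary 1 c"
    using assms(2) by (auto simp: kboundaries_def)
  have "w (singular_face 1 0 \<sigma>) = w (singular_face 1 1 \<sigma>)" if "\<sigma> \<in> Poly_Mapping.keys c" for \<sigma>
    using that assms(1) c by (auto simp: kchains_def)
  then show ?thesis
    by (simp add: b kboundary_def weighted_sum_sum weighted_sum_add)
qed

lemma weighted_sum_kboundaries_const:
  "b \<in> kboundaries 0 X \<Longrightarrow> weighted_sum (\<lambda>_. 1) b = 0"
  by (rule weighted_sum_kboundaries_0) simp_all

text \<open>Both points lie in the image of the standard 1-simplex under \<open>\<sigma>\<close>,
  which is path connected.\<close>

lemma path_component_of_singular_faces:
  assumes "singular_simplex 1 X \<sigma>"
  shows "path_component_of X (singular_face 1 0 \<sigma> vertex0) (singular_face 1 1 \<sigma> vertex0)"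
proof -
  let ?Z = "subtopology (powertop_real UNIV) (standard_simplex 1)"
  have cont: "continuous_map ?Z X \<sigma>"
    using assms by (simp add: singular_simplex_def)
  have "path_connectedin ?Z (standard_simplex 1)"
    by (simp add: path_connectedin_subtopology path_connectedin_standard_simplex)
  then have "path_connectedin X (\<sigma> ` standard_simplex 1)"
    by (rule path_connectedin_continuous_map_image[OF cont])
  moreover have "singular_face 1 k \<sigma> vertex0 \<in> \<sigma> ` standard_simplex 1" if "k \<le> 1" for k
    using simplical_face_in_standard_simplex[of 1 k vertex0] that
    by (simp add: singular_face_def del: One_nat_def)
  ultimately show ?thesis
    unfolding path_component_of by (meson le_numeral_extra(4) zero_le_one)
qed

lemma point_simplex_diff_kboundaries:
  assumes "path_component_of X x y"
  shows "Poly_Mapping.single (point_simplex y) 1 - Poly_Mapping.single (point_simplex x) (1::'k::field)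
    \<in> kboundaries 0 X"
proof -
  let ?Z = "subtopology (powertop_real UNIV) (standard_simplex 1)"
  obtain g where g: "pathin X g" "g 0 = x" "g 1 = y"
    using assms by (auto simp: path_component_of_def)
  \<comment> \<open>On the standard 1-simplex the barycentric coordinate \<open>t 1\<close> runs
    over \<open>{0..1}\<close> and serves as the path parameter.\<close>
  define \<sigma> where "\<sigma> = restrict (g \<circ> (\<lambda>t. t 1)) (standard_simplex 1)"
  have "continuous_map ?Z (top_of_set {0..1}) (\<lambda>t. t 1)"
    by (auto simp: continuous_map_in_subtopology standard_simplex_def
        intro!: continuous_map_from_subtopology continuous_map_product_projection)
  then have "continuous_map ?Z X (g \<circ> (\<lambda>t. t 1))"
    using g(1) unfolding pathin_def by (rule continuous_map_compose)
  then have "continuous_map ?Z X \<sigma>"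
    by (rule continuous_map_eq) (simp add: \<sigma>_def)
  then have \<sigma>: "singular_simplex 1 X \<sigma>"
    by (simp add: singular_simplex_def \<sigma>_def)
  have in1: "simplical_face k vertex0 \<in> standard_simplex 1" if "k \<le> 1" for k
    using simplical_face_in_standard_simplex[of 1 k vertex0] that by simp
  have face: "singular_face 1 k \<sigma> = point_simplex (g (simplical_face k vertex0 1))" if "k \<le> 1" for k
    using in1[OF that]
    by (intro extensionalityI[of _ "standard_simplex 0"])
      (auto simp: singular_face_def \<sigma>_def standard_simplex_0)
  \<comment> \<open>Face 0 omits vertex 0, so it sits at \<open>t 1 = 1\<close>, the end
    \<open>y\<close> of the path; face 1 sits at the start \<open>x\<close>. This fixes the sign of
    the boundary.\<close>
  have face0: "singular_face 1 0 \<sigma> = point_simplex y"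
    and face1: "singular_face 1 1 \<sigma> = point_simplex x"
    using face[of 0] face[of 1] g by (simp_all add: simplical_face_def)
  have "kboundary 1 (Poly_Mapping.single \<sigma> (1::'k)) =
      Poly_Mapping.single (point_simplex y) 1 - Poly_Mapping.single (point_simplex x) 1"
    using face0 face1 by (simp add: kboundary_def single_uminus)
  then show ?thesis
    using \<sigma> kchains_single[of \<sigma> 1 X "1::'k"] unfolding kboundaries_def
    by (auto intro!: image_eqI[of _ _ "Poly_Mapping.single \<sigma> 1"])
qed

text \<open>Replacing every simplex by one reference simplex \<open>\<tau>\<close> changes
  \<open>c\<close> by a boundary and leaves \<open>\<tau>\<close> with the coefficient sum of
  \<open>c\<close>, which is zero.\<close>

lemma kboundaries_0_path_connected:
  fixes c :: "('a, 'k::field) kchain"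
  assumes X: "path_connected_space X" and c: "c \<in> kchains 0 X" and z: "weighted_sum (\<lambda>_. 1) c = 0"
  shows "c \<in> kboundaries 0 X"
proof (cases "Poly_Mapping.keys c = {}")
  case True
  then show ?thesis
    by simp
next
  case False
  then obtain \<tau> where \<tau>: "\<tau> \<in> Poly_Mapping.keys c"
    by blast
  let ?s = "\<lambda>\<sigma>. Poly_Mapping.single \<sigma> (1::'k)"
  have "?s \<sigma> - ?s \<tau> \<in> kboundaries 0 X" if "\<sigma> \<in> Poly_Mapping.keys c" for \<sigma>
  proof -
    have "singular_simplex 0 X \<sigma>" "singular_simplex 0 X \<tau>"
      using that \<tau> c by (auto simp: kchains_def)
    note * = singular_simplex_0D[OF this(1)] singular_simplex_0D[OF this(2)]
    have "path_component_of X (\<tau> vertex0) (\<sigma> vertex0)"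
      using X * by (simp add: path_connected_space_imp_path_component_of)
    then show ?thesis
      using point_simplex_diff_kboundaries * by metis
  qed
  then have "(\<Sum>\<sigma>\<in>Poly_Mapping.keys c. kscale (Poly_Mapping.lookup c \<sigma>) (?s \<sigma> - ?s \<tau>))
      \<in> kboundaries 0 X"
    by (intro kboundaries_sum kboundaries_kscale)
  also have "(\<Sum>\<sigma>\<in>Poly_Mapping.keys c. kscale (Poly_Mapping.lookup c \<sigma>) (?s \<sigma> - ?s \<tau>)) =
      (\<Sum>\<sigma>\<in>Poly_Mapping.keys c. Poly_Mapping.single \<sigma> (Poly_Mapping.lookup c \<sigma>)) -
      Poly_Mapping.single \<tau> (\<Sum>\<sigma>\<in>Poly_Mapping.keys c. Poly_Mapping.lookup c \<sigma>)"
    by (simp add: kscale_diff kscale_single sum_subtractf single_sum)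
  also have "\<dots> = c"
    using z by (simp add: kchain_eq_sum[symmetric] weighted_sum_def)
  finally show ?thesis .
qed

section \<open>Augmentation in degree zero\<close>

definition augmentation :: "('a, 'k::field) kchain set \<Rightarrow> 'k" where
  "augmentation C = weighted_sum (\<lambda>_. 1) (SOME c. c \<in> C)"

text \<open>Boundaries have coefficient sum zero, so all representatives of a class agree and the
  choice made by \<open>SOME\<close> is harmless.\<close>

lemma augmentation_kclass: "augmentation (kclass 0 X c) = weighted_sum (\<lambda>_. 1) c"
proof -
  have "(SOME d. d \<in> kclass 0 X c) \<in> kclass 0 X c"
    by (rule someI) (rule kclass_self)
  then show ?thesis
    unfolding augmentation_def
    by (auto simp: kclass_def weighted_sum_add weighted_sum_kboundaries_const)
qed

lemma pm_space_interval_module: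
  "pm_space (interval_module I) r = \<lparr>carrier = (if r \<in> I then UNIV else {0}), mult = (*), one = 1,
    zero = 0, add = (+), smult = (*)\<rparr>"
  by (simp add: interval_module_def)

text \<open>Path connectedness gives injectivity, and multiples of a point of \<open>X\<close> give
  surjectivity. The empty space is covered too: it is path connected and both sides are
  zero.\<close>

lemma linear_iso_augmentation:
  assumes X: "path_connected_space X" and I: "r \<in> I \<longleftrightarrow> topspace X \<noteq> {}"
  shows "linear_iso (khomology 0 X) (pm_space (interval_module I :: ('k::field, 'k) persistence_module) r)
    augmentation"
proof -
  let ?\<epsilon> = "weighted_sum (\<lambda>_. 1) :: ('a, 'k) kchain \<Rightarrow> 'k"
  have "inj_on augmentation (carrier (khomology 0 X :: ('k, _) module))"
  proof (clarsimp simp: inj_on_def carrier_khomology_0 augmentation_kclass kclass_eq_iff)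
    fix c d :: "('a, 'k) kchain"
    assume cd: "c \<in> kchains 0 X" "d \<in> kchains 0 X" "?\<epsilon> c = ?\<epsilon> d"
    \<comment> \<open>The difference is written as a sum so that the rules for sums and multiples
      apply.\<close>
    have eq: "c - d = c + kscale (-1) d"
      by (rule poly_mapping_eqI) (simp add: lookup_minus lookup_add)
    show "c - d \<in> kboundaries 0 X"
      unfolding eq using cd X
      by (intro kboundaries_0_path_connected)
        (auto simp: weighted_sum_add weighted_sum_kscale kchains_add kchains_kscale)
  qed
  moreover have "?\<epsilon> ` kchains 0 X = (if r \<in> I then UNIV else {0})"
  proof (cases "r \<in> I")
    case True
    then obtain x where "x \<in> topspace X"
      using I by blast
    then have "a \<in> ?\<epsilon> ` kchains 0 X" for a
      by (intro image_eqI[of _ _ "Poly_Mapping.single (point_simplex x) a"])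
        (simp_all add: kchains_single singular_simplex_point)
    then show ?thesis
      using True by auto
  next
    case False
    then have "kchains 0 X = {0 :: ('a, 'k) kchain}"
      using I kchains_0_empty by blast
    then show ?thesis
      using False by simp
  qed
  then have "augmentation ` carrier (khomology 0 X) = (if r \<in> I then UNIV else {0::'k})"
    by (auto simp: carrier_khomology_0 image_image augmentation_kclass)
  ultimately show ?thesis
    unfolding linear_iso_def
    by (auto simp: bij_betw_def pm_space_interval_module carrier_khomology_0 khomology_add
        khomology_smult augmentation_kclass weighted_sum_add weighted_sum_kscale split: if_splits)
qed

text \<open>If the classes of two points have coordinates \<open>a\<close> and \<open>b\<close>, then \<open>b\<close> times the first minus
  \<open>a\<close> times the second is a boundary, whose total weight on every path component vanishes.\<close>

lemma path_connected_space_if_linear_iso: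
  fixes f :: "('a, 'k::field) kchain set \<Rightarrow> 'k"
  assumes f: "linear_iso (khomology 0 X) (pm_space (interval_module I) r) f"
  shows "path_connected_space X"
  unfolding path_connected_space_iff_path_component
proof (intro ballI)
  fix x y assume x: "x \<in> topspace X" and y: "y \<in> topspace X"
  let ?c = "\<lambda>x. Poly_Mapping.single (point_simplex x) (1::'k)"
  have chain: "?c x \<in> kchains 0 X" if "x \<in> topspace X" for x
    using that by (simp add: kchains_single singular_simplex_point)
  \<comment> \<open>Both possible carriers, the field and \<open>{0}\<close>, have the operations of
    the field, so \<open>r \<in> I\<close> and \<open>r \<notin> I\<close> are treated
    alike.\<close>
  have add: "f (kclass 0 X (c + d)) = f (kclass 0 X c) + f (kclass 0 X d)"
    if "c \<in> kchains 0 X" "d \<in> kchains 0 X" for c d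
    using f that
    by (simp add: linear_iso_def carrier_khomology_0 khomology_add pm_space_interval_module)
  have scale: "f (kclass 0 X (kscale a c)) = a * f (kclass 0 X c)" if "c \<in> kchains 0 X" for a c
    using f that
    by (simp add: linear_iso_def carrier_khomology_0 khomology_smult pm_space_interval_module)
  have ker: "c \<in> kboundaries 0 X" if "c \<in> kchains 0 X" "f (kclass 0 X c) = 0" for c
  proof -
    have "inj_on f (carrier (khomology 0 X))"
      using f by (simp add: linear_iso_def bij_betw_def)
    \<comment> \<open>The zero class goes to 0, because \<open>0 = kscale 0 0\<close>.\<close>
    moreover have "f (kclass 0 X c) = f (kclass 0 X 0)"
      using scale[of 0 0] that by simp
    ultimately have "kclass 0 X c = kclass 0 X 0"
      by (rule inj_onD) (use that in \<open>auto simp: carrier_khomology_0\<close>)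
    then show ?thesis
      by (simp add: kclass_eq_iff)
  qed
  define a where "a = f (kclass 0 X (?c x))"
  define b where "b = f (kclass 0 X (?c y))"
  \<comment> \<open>With \<open>a = 0\<close> the point simplex at \<open>x\<close> would be a
    boundary, yet its coefficient sum is 1.\<close>
  have "a \<noteq> 0"
    using ker[OF chain[OF x]] weighted_sum_kboundaries_const[of "?c x" X] by (auto simp: a_def)
  show "path_component_of X x y"
  proof (rule ccontr)
    assume neg: "\<not> path_component_of X x y"
    \<comment> \<open>The indicator of the path component of \<open>y\<close>. The two ends of a
      singular 1-simplex share a component, so this functional kills boundaries.\<close>
    define w :: "((nat \<Rightarrow> real) \<Rightarrow> 'a) \<Rightarrow> 'k" where
      "w \<sigma> = (if path_component_of X y (\<sigma> vertex0) then 1 else 0)" for \<sigma>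
    have w: "w (singular_face 1 0 \<sigma>) = w (singular_face 1 1 \<sigma>)" if "singular_simplex 1 X \<sigma>" for \<sigma>
    proof -
      have "path_component_of X y (singular_face 1 0 \<sigma> vertex0) \<longleftrightarrow>
          path_component_of X y (singular_face 1 1 \<sigma> vertex0)"
        using path_component_of_singular_faces[OF that]
        by (blast intro: path_component_of_sym path_component_of_trans)
      then show ?thesis
        by (simp add: w_def)
    qed
    have "kscale b (?c x) + kscale (- a) (?c y) \<in> kboundaries 0 X"
      by (rule ker) (simp_all add: add scale chain x y kchains_add kchains_kscale a_def b_def)
    then have "weighted_sum w (kscale b (?c x) + kscale (- a) (?c y)) = 0"
      using weighted_sum_kboundaries_0[of X w] w by blast
    \<comment> \<open>As \<open>x\<close> lies outside the component of \<open>y\<close>, the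
      functional takes the nonzero value \<open>- a\<close> on the boundary found above.\<close>
    moreover have "w (point_simplex x) = 0" "w (point_simplex y) = 1"
      using neg y
      by (auto simp: w_def path_component_of_refl path_component_of_sym_iff
          simp del: restrict_apply)
    ultimately show False
      using \<open>a \<noteq> 0\<close> by (simp add: weighted_sum_add weighted_sum_kscale)
  qed
qed


section \<open>Tubes around lines\<close>

lemma line_closed_convex_nonempty:
  assumes "line \<alpha>"
  shows "closed \<alpha>" "convex \<alpha>" "\<alpha> \<noteq> {}"
  using assms by (auto simp: line_def affine_closed affine_imp_convex)

text \<open>Distance to a convex set is a convex function: the same combination of nearest points
  bounds the distance of the combined point.\<close>

lemma convex_tubular_filtration:
  assumes X: "convex X" and \<alpha>: "line \<alpha>"
  shows "convex (tubular_filtration \<alpha> X r)"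
proof (rule convexI)
  note \<alpha>' = line_closed_convex_nonempty[OF \<alpha>]
  fix x y u v
  assume x: "x \<in> tubular_filtration \<alpha> X r" and y: "y \<in> tubular_filtration \<alpha> X r"
    and uv: "(0::real) \<le> u" "0 \<le> v" "u + v = 1"
  \<comment> \<open>Nearest points exist because a line is closed and nonempty.\<close>
  obtain p q where p: "p \<in> \<alpha>" "infdist x \<alpha> = dist x p" and q: "q \<in> \<alpha>" "infdist y \<alpha> = dist y q"
    using infdist_attains_inf[OF \<alpha>'(1,3)] by metis
  have "u *\<^sub>R p + v *\<^sub>R q \<in> \<alpha>"
    using \<alpha>'(2) p q uv by (simp add: convexD)
  then have "infdist (u *\<^sub>R x + v *\<^sub>R y) \<alpha> \<le> dist (u *\<^sub>R x + v *\<^sub>R y) (u *\<^sub>R p + v *\<^sub>R q)"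
    by (rule infdist_le)
  also have "\<dots> \<le> norm (u *\<^sub>R (x - p)) + norm (v *\<^sub>R (y - q))"
    unfolding dist_norm by (rule order_trans[OF _ norm_triangle_ineq]) (simp add: algebra_simps)
  also have "\<dots> = u * dist x p + v * dist y q"
    using uv by (simp add: dist_norm)
  also have "\<dots> \<le> u * r + v * r"
    using x y uv p q
    by (intro add_mono mult_left_mono) (auto simp: tubular_filtration_def tubular_function_def)
  also have "\<dots> = r"
    using uv by (metis distrib_right mult_1)
  finally show "u *\<^sub>R x + v *\<^sub>R y \<in> tubular_filtration \<alpha> X r"
    using x y uv X by (simp add: tubular_filtration_def tubular_function_def convexD)
qed

section \<open>Convex sets have one interval\<close>

lemma one_interval_if_convex:
  assumes X: "convex X" "X \<noteq> {}" and \<alpha>: "line \<alpha>"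
  shows "diagram_has_exactly_one_interval
    (tubular_persistence_module 0 \<alpha> X ::
      ('k::field, ('a::euclidean_space, 'k) kchain set) persistence_module)"
proof -
  let ?X = "tubular_filtration \<alpha> X"
  \<comment> \<open>The radii with nonempty tube. Tubes grow with the radius, so this is an
    unbounded interval; its left end may be missing, as \<open>X\<close> need not be closed.\<close>
  define I where "I = {r. 0 \<le> r \<and> ?X r \<noteq> {}}"
  have mono: "?X r \<subseteq> ?X s" if "r \<le> s" for r s
    using that by (auto simp: tubular_filtration_def)
  then have up: "s \<in> I" if "r \<in> I" "r \<le> s" for r s
    using that by (fastforce simp: I_def)
  obtain x where "x \<in> X"
    using X by blast
  then have "infdist x \<alpha> \<in> I"
    by (auto simp: I_def tubular_filtration_def tubular_function_def infdist_nonneg)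
  moreover have "is_interval I"
    unfolding is_interval_1 using up by blast
  moreover have "persistence_isomorphic (tubular_persistence_module 0 \<alpha> X)
      (interval_module I :: ('k, 'k) persistence_module)"
    unfolding persistence_isomorphic_def
  \<comment> \<open>The augmentation serves at every index: inclusions keep coefficient sums, so the
    squares commute.\<close>
  proof (intro exI[of _ "\<lambda>_. augmentation"] conjI allI impI ballI)
    fix r :: real assume "0 \<le> r"
    have "path_connected_space (top_of_set (?X r))"
      using convex_tubular_filtration[OF X(1) \<alpha>]
      by (simp add: convex_imp_path_connected path_connected_space_euclidean_subtopology)
    then show "linear_iso (pm_space (tubular_persistence_module 0 \<alpha> X) r)
        (pm_space (interval_module I :: ('k, 'k) persistence_module) r) augmentation"
      using \<open>0 \<le> r\<close> unfolding tubular_persistence_module_def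
      by (auto simp: I_def intro!: linear_iso_augmentation)
  next
    fix r s :: real and C :: "('a, 'k) kchain set"
    assume rs: "0 \<le> r" "r \<le> s" and C: "C \<in> carrier (pm_space (tubular_persistence_module 0 \<alpha> X) r)"
    then obtain c where c: "c \<in> kchains 0 (top_of_set (?X r))"
      and C_eq: "C = kclass 0 (top_of_set (?X r)) c"
      by (auto simp: tubular_persistence_module_def carrier_khomology_0)
    \<comment> \<open>The interval module maps to zero from an index outside \<open>I\<close>; there
      the tube is empty and the only chain is 0, so both sides vanish.\<close>
    have "weighted_sum (\<lambda>_. 1) c = 0" if "r \<notin> I"
    proof -
      have "topspace (top_of_set (?X r)) = {}"
        using that rs by (simp add: I_def)
      then have "c = 0"
        using c kchains_0_empty by blast
      then show ?thesis
        by simp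
    qed
    then show "augmentation (pm_map (tubular_persistence_module 0 \<alpha> X) r s C) =
        pm_map (interval_module I) r s (augmentation C)"
      using up[OF _ rs(2)]
      by (auto simp: tubular_persistence_module_def interval_module_def C_eq augmentation_kclass
          khom_induced_inclusion[OF mono[OF rs(2)] c])
  qed
  ultimately show ?thesis
    unfolding diagram_has_exactly_one_interval_def using I_def by (intro exI[of _ I]) auto
qed

section \<open>Convexity from sections by lines\<close>

lemma line_affine_hull_pair: "x \<noteq> y \<Longrightarrow> line (affine hull {x, y})"
  by (simp add: line_def aff_dim_affine_hull aff_dim_2)

text \<open>A segment lies in the line through its ends, and a connected collinear set is
  convex.\<close>

lemma convex_if_path_connected_Int_lines:
  fixes X :: "'a::euclidean_space set"
  assumes "\<And>\<alpha>. line \<alpha> \<Longrightarrow> path_connected (X \<inter> \<alpha>)"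
  shows "convex X"
proof (rule convexI)
  fix x y and u v :: real
  assume xy: "x \<in> X" "y \<in> X" and uv: "0 \<le> u" "0 \<le> v" "u + v = 1"
  show "u *\<^sub>R x + v *\<^sub>R y \<in> X"
  \<comment> \<open>Coinciding points do not span a line, so they are treated apart.\<close>
  proof (cases "x = y")
    case True
    then show ?thesis
      using xy uv by (metis scaleR_left_distrib scaleR_one)
  next
    case False
    let ?\<alpha> = "affine hull {x, y}"
    have "connected (X \<inter> ?\<alpha>)"
      using assms line_affine_hull_pair[OF False] path_connected_imp_connected by blast
    moreover have "collinear (X \<inter> ?\<alpha>)"
      by (meson collinear_affine_hull_collinear collinear_2 collinear_subset inf_le2)
    ultimately have "convex (X \<inter> ?\<alpha>)"
      using convex_connected_collinear by blast
    then show ?thesis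
      using xy uv by (meson Int_iff convexD hull_inc insertI1 insertI2)
  qed
qed

text \<open>Nonemptiness excludes the degenerate case: the empty set is convex, but all its tubes
  are empty and its diagram contains no interval.\<close>

theorem theorem1:
  fixes X :: "(real ^ 'n) set"
  assumes "triangulizable X"
    and "X \<noteq> {}"
  shows "convex X \<longleftrightarrow>
    (\<forall>\<alpha>. line \<alpha> \<longrightarrow>
      diagram_has_exactly_one_interval
        (tubular_persistence_module 0 \<alpha> X ::
          ('k::field, (real ^ 'n, 'k) kchain set) persistence_module))"
proof (intro iffI allI impI)
  fix \<alpha> :: "(real ^ 'n) set"
  assume "convex X" "line \<alpha>"
  then show "diagram_has_exactly_one_interval (tubular_persistence_module 0 \<alpha> X ::
      ('k, (real ^ 'n, 'k) kchain set) persistence_module)"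
    using assms(2) one_interval_if_convex by blast
next
  assume one: "\<forall>\<alpha>. line \<alpha> \<longrightarrow> diagram_has_exactly_one_interval
    (tubular_persistence_module 0 \<alpha> X :: ('k, (real ^ 'n, 'k) kchain set) persistence_module)"
  show "convex X"
  proof (rule convex_if_path_connected_Int_lines)
    fix \<alpha> :: "(real ^ 'n) set"
    assume \<alpha>: "line \<alpha>"
    \<comment> \<open>Only the component at index 0 of the isomorphism is kept.\<close>
    then obtain I \<phi> where "linear_iso
        (pm_space (tubular_persistence_module 0 \<alpha> X ::
          ('k, (real ^ 'n, 'k) kchain set) persistence_module) 0)
        (pm_space (interval_module I :: ('k, 'k) persistence_module) 0) (\<phi> (0::real))"
      using one unfolding diagram_has_exactly_one_interval_def persistence_isomorphic_def
      by (metis order_refl)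
    then have "path_connected (tubular_filtration \<alpha> X 0)"
      using path_connected_space_if_linear_iso[of "top_of_set (tubular_filtration \<alpha> X 0)" I 0]
      by (simp add: tubular_persistence_module_def path_connected_space_euclidean_subtopology)
    moreover have "tubular_filtration \<alpha> X 0 = X \<inter> \<alpha>"
    proof -
      \<comment> \<open>A line is closed, so distance zero means membership.\<close>
      have "infdist x \<alpha> \<le> 0 \<longleftrightarrow> x \<in> \<alpha>" for x
        using in_closed_iff_infdist_zero[OF line_closed_convex_nonempty(1,3), OF \<alpha> \<alpha>, of x]
          infdist_nonneg[of x \<alpha>]
        by linarith
      then show ?thesis
        by (auto simp: tubular_filtration_def tubular_function_def)
    qed
    ultimately show "path_connected (X \<inter> \<alpha>)"
      by simp
  qed
qed

end
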